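(* For every integer $n\geq 2$, $$L_{n+1}(q)=3L_n(q)+2(q-1)L_{n-1}(q).$$
   Context: Define polynomials $b_n(q)$, $n\geq 1$, by $b_1(q)=1$ and, for $n\geq 1$ (and for the second and third relations also $n\geq 0$ whenever the indices involved are $\geq 1$), $b_{2n}(q)=b_n(q)$, $b_{4n+1}(q)=q\,b_{2n}(q)+b_{2n+1}(q)$, $b_{4n+3}(q)=b_{2n+1}(q)+q\,b_{2n+2}(q)$. For $n\geq 1$ let $L_n(q)=2\left(\sum_{k=1}^{2^n-1}b_k(q)\right)+b_{2^n}(q)$. *)

theory Defs
  imports "HOL-Computational_Algebra.Polynomial"
begin

abbreviation q :: "int poly" where
  "q \<equiv> [:0, 1:]"

text \<open>The sequence is indexed from 1; the value at index 0 is a dummy that no other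
  equation refers to.\<close>

function b :: "nat \<Rightarrow> int poly" where
  "b 0 = 0"
| "b (Suc 0) = 1"
| "n \<ge> 1 \<Longrightarrow> b (2 * n) = b n"
| "n \<ge> 1 \<Longrightarrow> b (4 * n + 1) = q * b (2 * n) + b (2 * n + 1)"
| "b (4 * n + 3) = b (2 * n + 1) + q * b (2 * n + 2)"
  by (atomize_elim, presburger) (rule refl | (rule FalseE, presburger) | simp)+
termination
  by (relation "measure id") auto

definition L :: "nat \<Rightarrow> int poly" where
  "L n = 2 * (\<Sum>k = 1..2 ^ n - 1. b k) + b (2 ^ n)"

end

theory Submission
  imports Defs
begin

text \<open>Since \<open>b 0 = 0\<close>, \<open>L n\<close> is the trapezoidal sum of \<open>b\<close> over \<open>0, \<dots>, 2 ^ n\<close>. Because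
  \<open>b (2 * k) = b k\<close>, this range reappears as the even points of \<open>0, \<dots>, 2 ^ (n + 1)\<close>, so passing
  to \<open>L (n + 1)\<close> only adds twice the sum of \<open>b\<close> over the odd points. The odd-index recurrences
  express the next such midpoint sum through \<open>L n\<close> and the present one; eliminating the midpoint
  sums leaves the three-term recurrence.\<close>

definition trapezoidal_sum :: "(nat \<Rightarrow> 'a::comm_semiring_1) \<Rightarrow> nat \<Rightarrow> 'a" where
  "trapezoidal_sum f N = (\<Sum>k<N. f k + f (k + 1))"

definition midpoint_sum :: "(nat \<Rightarrow> 'a::comm_semiring_1) \<Rightarrow> nat \<Rightarrow> 'a" where
  "midpoint_sum f N = (\<Sum>k<N. f (2 * k + 1))"

lemma sum_lessThan_double:
  fixes f :: "nat \<Rightarrow> 'a::comm_monoid_add"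
  shows "(\<Sum>k<2 * N. f k) = (\<Sum>k<N. f (2 * k) + f (2 * k + 1))"
  by (induction N) (simp_all add: add_ac)

lemma trapezoidal_sum_Suc:
  "trapezoidal_sum f (Suc N) = f 0 + 2 * (\<Sum>k = 1..N. f k) + f (Suc N)"
  by (induction N) (simp_all add: trapezoidal_sum_def mult_2 add_ac)

lemma trapezoidal_sum_double:
  "trapezoidal_sum f (2 * N) = trapezoidal_sum (\<lambda>k. f (2 * k)) N + 2 * midpoint_sum f N"
  unfolding trapezoidal_sum_def midpoint_sum_def sum_lessThan_double
  by (simp add: sum.distrib mult_2 add_ac)

lemma b_double: "b (2 * n) = b n"
  using b.simps(3)[of n] by (cases "n = 0") simp_all

text \<open>The case \<open>n = 0\<close> relies on the dummy value \<open>b 0 = 0\<close>.\<close>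
lemma b_4n_plus_1: "b (4 * n + 1) = q * b n + b (2 * n + 1)"
proof (cases "n = 0")
  case False
  then show ?thesis
    using b.simps(4)[of n] b_double[of n] by simp
qed simp

lemma b_4n_plus_3: "b (4 * n + 3) = b (2 * n + 1) + q * b (n + 1)"
  using b.simps(5)[of n] b_double[of "n + 1"] by simp

lemma trapezoidal_sum_b_double:
  "trapezoidal_sum b (2 * N) = trapezoidal_sum b N + 2 * midpoint_sum b N"
  by (simp only: trapezoidal_sum_double b_double)

lemma midpoint_sum_b_double:
  "midpoint_sum b (2 * N) = q * trapezoidal_sum b N + 2 * midpoint_sum b N"
proof -
  have "midpoint_sum b (2 * N) = (\<Sum>k<N. b (4 * k + 1) + b (4 * k + 3))"
    by (simp add: midpoint_sum_def sum_lessThan_double numeral_3_eq_3)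
  also have "\<dots> = (\<Sum>k<N. q * (b k + b (k + 1)) + 2 * b (2 * k + 1))"
    unfolding b_4n_plus_1 b_4n_plus_3
    by (simp only: distrib_left mult_2[of "b _"] add_ac)
  also have "\<dots> = q * trapezoidal_sum b N + 2 * midpoint_sum b N"
    by (simp only: trapezoidal_sum_def midpoint_sum_def sum.distrib
        distrib_left sum_distrib_left)
  finally show ?thesis .
qed

lemma L_eq_trapezoidal_sum: "L n = trapezoidal_sum b (2 ^ n)"
  using trapezoidal_sum_Suc[of b "2 ^ n - 1"] by (simp add: L_def)

lemma L_Suc: "L (Suc n) = L n + 2 * midpoint_sum b (2 ^ n)"
  by (simp only: L_eq_trapezoidal_sum power_Suc trapezoidal_sum_b_double)

theorem theorem2p1:
  fixes n :: nat
  assumes "n \<ge> 2"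
  shows "L (n + 1) = 3 * L n + 2 * (q - 1) * L (n - 1)"
proof -
  obtain m where n: "n = Suc m"
    using assms by (cases n) auto
  have "L (Suc (Suc m)) = L (Suc m) + 2 * midpoint_sum b (2 * 2 ^ m)"
    by (simp only: L_Suc[of "Suc m"] power_Suc)
  also have "\<dots> = L (Suc m) + 2 * (q * L m + 2 * midpoint_sum b (2 ^ m))"
    by (simp only: midpoint_sum_b_double L_eq_trapezoidal_sum)
  also have "\<dots> = 3 * L (Suc m) + 2 * (q - 1) * L m"
    using L_Suc[of m] by algebra
  finally show ?thesis
    by (simp add: n)
qed

end
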